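(* Let $\mathcal{F}=\{f_d\}_{d=0}^\infty$ be an admissible sequence of polynomials, let $n$ be a positive integer and $\boldsymbol{x}=(x_1,\dots,x_n)$. For every strict partition $\lambda$ of length $l\le n$ we have $$P^{\mathcal F}_\lambda(\boldsymbol{x})=\mathbb{P}^{\mathcal F}_\lambda(\boldsymbol{x};-1).$$
   Context: $K$ is a field of characteristic $0$. A sequence $\mathcal F=\{f_d\}_{d=0}^\infty$ of polynomials $f_d(u)\in K[u]$ is admissible if $f_0=1$ and $\deg f_d=d$ for all $d\ge 1$. A partition of length $l$ is a weakly decreasing sequence $(\lambda_1,\dots,\lambda_l)$ of positive integers; it is strict if $\lambda_1>\dots>\lambda_l$ (the empty sequence $\emptyset$ is the strict partition of length $0$). ${}^tM$ denotes the transpose of $M$, $O$ a zero matrix, and $\mathrm{Pf}$ the Pfaffian (the empty Pfaffian is $1$). For indeterminates $\boldsymbol{x}=(x_1,\dots,x_n)$ put $A(\boldsymbol{x})=\left(\frac{x_j-x_i}{x_j+x_i}\right)_{1\le i,j\le n}$ and $\Delta(\boldsymbol{x})=\prod_{1\le i<j\le n}\frac{x_j-x_i}{x_j+x_i}$. For a sequence $\alpha=(\alpha_1,\dots,\alpha_r)$ of nonnegative integers let $V^{\mathcal F}_\alpha(\boldsymbol{x})=(f_{\alpha_j}(x_i))_{1\le i\le n,\,1\le j\le r}$. For a strict partition $\lambda$ of length $l$ (any $l\ge 0$), the generalized $P$-function is $$P^{\mathcal F}_\lambda(\boldsymbol{x})=\frac{1}{\Delta(\boldsymbol{x})}\mathrm{Pf}\begin{pmatrix}A(\boldsymbol{x})&V^{\mathcal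 F}_{\lambda^*}(\boldsymbol{x})\\-{}^tV^{\mathcal F}_{\lambda^*}(\boldsymbol{x})&O\end{pmatrix},$$ where $\lambda^*=\lambda$ if $n+l$ is even and $\lambda^*=\lambda^0=(\lambda_1,\dots,\lambda_l,0)$ if $n+l$ is odd. For a partition $\lambda$ of length $\le n$, regarded as a sequence $(\lambda_1,\dots,\lambda_n)$ of length $n$ by appending zeros, let $v^{(n)}_\lambda(t)=\prod_{k\ge 0}[m_k]_t!$, where $m_k=\#\{i:1\le i\le n,\ \lambda_i=k\}$ and $[m]_t!=\prod_{j=1}^m\frac{1-t^j}{1-t}$. The generalized Hall--Littlewood function is $$\mathbb{P}^{\mathcal F}_\lambda(\boldsymbol{x};t)=\frac{1}{v^{(n)}_\lambda(t)}\sum_{w\in S_n}w\left(\prod_{i=1}^n f_{\lambda_i}(x_i)\prod_{1\le i<j\le n}\frac{x_i-tx_j}{x_i-x_j}\right),$$ where the symmetric group $S_n$ permutes the variables $x_1,\dots,x_n$. $\mathbb{P}^{\mathcal F}_\lambda(\boldsymbol{x};-1)$ denotes the value at $t=-1$ of this rational function, taken after cancelling common factors (for strict $\lambda$ it is regular at $t=-1$). *)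

theory Defs
  imports
    "HOL-Library.Poly_Mapping"
    "HOL-Computational_Algebra.Polynomial_Factorial"
    "HOL-Combinatorics.Permutations"
    "Jordan_Normal_Form.Matrix"
begin

section \<open>Admissible sequences and strict partitions\<close>

definition admissible :: "(nat \<Rightarrow> 'a::field_char_0 poly) \<Rightarrow> bool" where
  "admissible f \<longleftrightarrow> f 0 = 1 \<and> (\<forall>d\<ge>1. degree (f d) = d)"

definition strict_partition :: "nat list \<Rightarrow> bool" where
  "strict_partition lam \<longleftrightarrow> sorted_wrt (>) lam \<and> (\<forall>k\<in>set lam. k > 0)"


section \<open>Pfaffians\<close>

text \<open>Only meaningful for skew-symmetric matrices of even size over a field of characteristic 0.\<close>

definition pfaffian :: "'b::field mat \<Rightarrow> 'b" where
  "pfaffian M = (let m = dim_row M div 2 in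
     (\<Sum>p | p permutes {..<2*m}. of_int (sign p) * (\<Prod>i<m. M $$ (p (2*i), p (2*i+1))))
       / of_nat (2 ^ m * fact m))"


section \<open>The two families over an arbitrary field\<close>

text \<open>
  The variables are numbered from 0: the paper's $x_i$ is \<open>x (i - 1)\<close>, and only
  \<open>x 0, \<dots>, x (n - 1)\<close> are used.  In this section they are elements of an arbitrary
  field that also contains the coefficients of the polynomials \<open>f d\<close>; indeterminates are
  substituted below.
\<close>

definition matA :: "nat \<Rightarrow> (nat \<Rightarrow> 'b::field) \<Rightarrow> 'b mat" where
  "matA n x = mat n n (\<lambda>(i, j). (x j - x i) / (x j + x i))"

definition Delta :: "nat \<Rightarrow> (nat \<Rightarrow> 'b::field) \<Rightarrow> 'b" where
  "Delta n x = (\<Prod>j<n. \<Prod>i<j. (x j - x i) / (x j + x i))"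

definition matV :: "(nat \<Rightarrow> 'b::field poly) \<Rightarrow> nat \<Rightarrow> nat list \<Rightarrow> (nat \<Rightarrow> 'b) \<Rightarrow> 'b mat" where
  "matV f n \<alpha> x = mat n (length \<alpha>) (\<lambda>(i, j). poly (f (\<alpha> ! j)) (x i))"

definition star_partition :: "nat \<Rightarrow> nat list \<Rightarrow> nat list" where
  "star_partition n lam = (if even (n + length lam) then lam else lam @ [0])"

definition P_at :: "(nat \<Rightarrow> 'b::field poly) \<Rightarrow> nat \<Rightarrow> nat list \<Rightarrow> (nat \<Rightarrow> 'b) \<Rightarrow> 'b" where
  "P_at f n lam x =
     (let \<mu> = star_partition n lam; r = length \<mu>; V = matV f n \<mu> x in
      pfaffian (four_block_mat (matA n x) V (- transpose_mat V) (0\<^sub>m r r)) / Delta n x)"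

definition q_fact :: "'b::field \<Rightarrow> nat \<Rightarrow> 'b" where
  "q_fact t m = (\<Prod>j=1..m. (1 - t ^ j) / (1 - t))"

definition pad :: "nat \<Rightarrow> nat list \<Rightarrow> nat list" where
  "pad n lam = lam @ replicate (n - length lam) 0"

text \<open>The product is restricted to the parts that occur; the other factors are \<open>q_fact t 0 = 1\<close>.\<close>

definition v_coeff :: "nat \<Rightarrow> nat list \<Rightarrow> 'b::field \<Rightarrow> 'b" where
  "v_coeff n lam t = (\<Prod>k\<in>set (pad n lam). q_fact t (count_list (pad n lam) k))"

definition HL_term ::
    "(nat \<Rightarrow> 'b::field poly) \<Rightarrow> nat \<Rightarrow> nat list \<Rightarrow> (nat \<Rightarrow> 'b) \<Rightarrow> 'b \<Rightarrow> 'b" where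
  "HL_term f n lam x t =
     (\<Prod>i<n. poly (f (pad n lam ! i)) (x i)) *
     (\<Prod>j<n. \<Prod>i<j. (x i - t * x j) / (x i - x j))"

definition HL_at ::
    "(nat \<Rightarrow> 'b::field poly) \<Rightarrow> nat \<Rightarrow> nat list \<Rightarrow> (nat \<Rightarrow> 'b) \<Rightarrow> 'b \<Rightarrow> 'b" where
  "HL_at f n lam x t =
     (\<Sum>w | w permutes {..<n}. HL_term f n lam (\<lambda>i. x (w i)) t) / v_coeff n lam t"


section \<open>Rational functions in the indeterminates\<close>

text \<open>
  \<open>'a ratfun\<close> is the fraction field of the polynomial ring over \<open>'a\<close> in countably many
  indeterminates \<open>X 0, X 1, \<dots>\<close> (exponent vectors are finitely supported functions); the
  field $K(x_1,\dots,x_n)$ is the subfield generated by the constants and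
  \<open>X 0, \<dots>, X (n - 1)\<close>.  The parameter \<open>t\<close> is one more indeterminate, adjoined on top.
\<close>

type_synonym 'a ratfun = "((nat, nat) poly_mapping, 'a) poly_mapping fract"
type_synonym 'a ratfun_t = "'a ratfun poly fract"

definition X :: "nat \<Rightarrow> 'a::field_char_0 ratfun" where
  "X i = to_fract (Poly_Mapping.single (Poly_Mapping.single i 1) 1)"

definition const :: "'a::field_char_0 \<Rightarrow> 'a ratfun" where
  "const c = to_fract (Poly_Mapping.single 0 c)"

definition lift_t :: "'b::field \<Rightarrow> 'b poly fract" where
  "lift_t c = to_fract [:c:]"

definition T :: "'b::field poly fract" where
  "T = to_fract [:0, 1:]"

definition gen_P :: "(nat \<Rightarrow> 'a::field_char_0 poly) \<Rightarrow> nat \<Rightarrow> nat list \<Rightarrow> 'a ratfun" where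
  "gen_P f n lam = P_at (\<lambda>d. map_poly const (f d)) n lam X"

definition gen_HL :: "(nat \<Rightarrow> 'a::field_char_0 poly) \<Rightarrow> nat \<Rightarrow> nat list \<Rightarrow> 'a ratfun_t" where
  "gen_HL f n lam =
     HL_at (\<lambda>d. map_poly (\<lambda>c. lift_t (const c)) (f d)) n lam (\<lambda>i. lift_t (X i)) T"


section \<open>Values of rational functions in one variable\<close>

definition has_value :: "'b::field poly fract \<Rightarrow> 'b \<Rightarrow> 'b \<Rightarrow> bool" where
  "has_value r a c \<longleftrightarrow>
     (\<exists>p q. poly q a \<noteq> 0 \<and> r = Fraction_Field.Fract p q \<and> c = poly p a / poly q a)"

definition regular_at :: "'b::field poly fract \<Rightarrow> 'b \<Rightarrow> bool" where
  "regular_at r a \<longleftrightarrow> (\<exists>c. has_value r a c)"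

definition value_at :: "'b::field poly fract \<Rightarrow> 'b \<Rightarrow> 'b" where
  "value_at r a = (THE c. has_value r a c)"

lemma has_value_unique:
  assumes "has_value r a c" "has_value r a d"
  shows "c = d"
proof -
  obtain p q where 1: "poly q a \<noteq> 0" "r = Fraction_Field.Fract p q" "c = poly p a / poly q a"
    using assms(1) by (auto simp: has_value_def)
  obtain p' q' where 2: "poly q' a \<noteq> 0" "r = Fraction_Field.Fract p' q'" "d = poly p' a / poly q' a"
    using assms(2) by (auto simp: has_value_def)
  have "q \<noteq> 0" "q' \<noteq> 0"
    using 1(1) 2(1) by auto
  then have "p * q' = p' * q"
    using 1(2) 2(2) by (simp add: eq_fract)
  then have "poly p a * poly q' a = poly p' a * poly q a"
    by (metis poly_mult)
  then show ?thesis
    using 1(1,3) 2(1,3) by (simp add: frac_eq_eq)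
qed

lemma value_at_eqI: "has_value r a c \<Longrightarrow> value_at r a = c"
  unfolding value_at_def using has_value_unique by blast

text \<open>This is the value obtained by cancelling common factors and then substituting.\<close>

lemma regular_at_coprime_iff:
  fixes p q :: "'b::field poly"
  assumes "coprime p q" "q \<noteq> 0"
  shows "regular_at (Fraction_Field.Fract p q) a \<longleftrightarrow> poly q a \<noteq> 0"
proof
  assume "regular_at (Fraction_Field.Fract p q) a"
  then obtain p' q' where 1: "poly q' a \<noteq> 0"
      "Fraction_Field.Fract p q = Fraction_Field.Fract p' q'"
    by (auto simp: regular_at_def has_value_def)
  then have "q' \<noteq> 0"
    by auto
  then have "p * q' = p' * q"
    using 1(2) assms(2) by (simp add: eq_fract)
  then have eq: "poly p a * poly q' a = poly p' a * poly q a"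
    by (metis poly_mult)
  show "poly q a \<noteq> 0"
  proof
    assume q0: "poly q a = 0"
    with eq 1(1) have "poly p a = 0"
      by simp
    with q0 have "[:- a, 1:] dvd p" "[:- a, 1:] dvd q"
      by (simp_all add: poly_eq_0_iff_dvd)
    with assms(1) have "is_unit [:- a, 1:]"
      by (rule coprime_common_divisor)
    then show False
      by (simp add: is_unit_poly_iff)
  qed
qed (auto simp: regular_at_def has_value_def)

lemma value_at_Fract:
  "poly q a \<noteq> 0 \<Longrightarrow> value_at (Fraction_Field.Fract p q) a = poly p a / poly q a"
  by (rule value_at_eqI) (auto simp: has_value_def)

end

theory Submission
  imports Defs
begin

text \<open>
  Both sides satisfy the same recursion, which removes the first part of \<open>lam\<close> together with
  one variable.  Let \<open>H\<close> (the function \<open>hl_rec\<close> below) be defined by \<open>H [] = 1\<close> and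
  \[ H_{(k, \kappa)}(x_1, \dots, x_n; t) = \sum_{i} f_k(x_i) \prod_{j \ne i}
     \frac{x_i - t x_j}{x_i - x_j} \, H_\kappa(x_1, \dots, \widehat{x_i}, \dots, x_n; t). \]
  Everything follows from two evaluations of this function.

  For the Hall--Littlewood side, the permutations \<open>w\<close> are sorted by \<open>w 0 = i\<close>.  This gives the
  recursion for the unnormalised sum, down to the sum for \<open>[]\<close> in \<open>n - length lam\<close>
  variables, which is the \<open>t\<close>-factorial of \<open>n - length lam\<close> by a partial fraction
  identity.  For a strict partition this is the normalising factor \<open>v_coeff\<close>, whence
  \<open>HL_at_eq_hl_rec\<close>.  Cancelling it at generic \<open>t\<close> is essential, because it vanishes at
  \<open>t = - 1\<close> as soon as two zeros are appended.  What remains, \<open>H\<close>, has only the factors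
  \<open>x i - x j\<close> in its denominators, so it is regular at \<open>t = - 1\<close> and its value there is
  found by substitution (\<open>has_value_hl_rec\<close>).

  For the Pfaffian side, the block matrix is expanded along the row of the first part.  The
  minors are block matrices of the same kind, and the signs of the expansion are the ones
  that come out of comparing \<open>Delta\<close> in \<open>n\<close> and in \<open>n - 1\<close> variables (\<open>Delta_skip\<close>).  Hence
  the quotient by \<open>Delta\<close> satisfies the recursion of \<open>H\<close> at \<open>t = - 1\<close>
  (\<open>P_quot_Cons\<close>).  When no part is left, an even number of variables leads to Schur's
  Pfaffian \<open>Pf A = Delta\<close> (\<open>schur_pfaffian\<close>), and an odd number to one further step with the
  appended part \<open>0\<close>.  Together this is \<open>P_at_eq_hl_rec\<close>.

  Both partial fraction identities express the leading coefficient of a polynomial through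
  its values at suitable points (\<open>lagrange_leading_coeff\<close>).
\<close>

section \<open>Permutations with a prescribed first value\<close>

text \<open>
  The increasing enumeration of the natural numbers other than \<open>c\<close>: \<open>\<lambda>j. x (skip c j)\<close> is
  the sequence \<open>x\<close> without its entry number \<open>c\<close>.
\<close>

definition skip :: "nat \<Rightarrow> nat \<Rightarrow> nat" where
  "skip c k = (if k < c then k else Suc k)"

definition insert_front :: "nat \<Rightarrow> (nat \<Rightarrow> nat) \<Rightarrow> nat \<Rightarrow> nat" where
  "insert_front c q = case_nat c (\<lambda>k. skip c (q k))"

lemma insert_front_0 [simp]: "insert_front c q 0 = c"
  and insert_front_Suc [simp]: "insert_front c q (Suc k) = skip c (q k)"
  by (simp_all add: insert_front_def)

lemma skip_neq [simp]: "skip c k \<noteq> c" "c \<noteq> skip c k"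
  by (auto simp: skip_def)

lemma skip_eq_iff [simp]: "skip c j = skip c k \<longleftrightarrow> j = k"
  by (auto simp: skip_def)

lemma skip_less: "k < n \<Longrightarrow> skip c k < Suc n"
  by (auto simp: skip_def)

lemma skip_image:
  assumes "c \<le> n"
  shows "skip c ` {..<n} = {..<Suc n} - {c}"
proof -
  have "x \<in> skip c ` {..<n}" if "x < Suc n" "x \<noteq> c" for x
    using that assms
    by (intro image_eqI[where x = "if x < c then x else x - 1"]) (auto simp: skip_def)
  then show ?thesis
    by (auto simp: skip_less)
qed

lemma prod_skip:
  fixes g :: "nat \<Rightarrow> 'b::comm_monoid_mult"
  assumes "c \<le> n"
  shows "(\<Prod>k<n. g (skip c k)) = (\<Prod>k\<in>{..<Suc n} - {c}. g k)"
  unfolding skip_image[OF assms, symmetric]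
  by (subst prod.reindex) (auto simp: inj_on_def)

lemma insert_front_permutes:
  assumes q: "q permutes {..<n}" and c: "c \<le> n"
  shows "insert_front c q permutes {..<Suc n}"
proof (rule inj_imp_permutes)
  have q_eq: "q j = q k \<longleftrightarrow> j = k" for j k
    using permutes_inj[OF q] by (simp add: inj_eq)
  have "x = y" if "insert_front c q x = insert_front c q y" for x y
    using that by (cases x; cases y) (simp_all add: q_eq)
  then show "inj_on (insert_front c q) {..<Suc n}"
    by (blast intro: inj_onI)
  show "insert_front c q x \<in> {..<Suc n}" if "x \<in> {..<Suc n}" for x
  proof (cases x)
    case (Suc k)
    then have "q k < n"
      using that permutes_in_image[OF q, of k] by simp
    with Suc show ?thesis
      by (simp add: skip_less del: lessThan_Suc)
  qed (use c in simp)
  show "insert_front c q x = x" if "x \<notin> {..<Suc n}" for x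
  proof (cases x)
    case (Suc k)
    then have "q k = k"
      using that permutes_not_in[OF q, of k] by simp
    with Suc that c show ?thesis
      by (simp add: skip_def)
  qed (use that in simp)
qed simp

text \<open>
  Injectivity is enough: \<open>(n + 1) * n! = (n + 1)!\<close> makes the two sets equally large.
\<close>

lemma bij_betw_insert_front:
  "bij_betw (\<lambda>(c, q). insert_front c q) ({..n} \<times> {q. q permutes {..<n}})
     {p. p permutes {..<Suc n}}"
proof -
  let ?D = "{..n} \<times> {q. q permutes {..<n}}"
  have inj: "inj_on (\<lambda>(c, q). insert_front c q) ?D"
  proof (rule inj_onI, clarsimp)
    fix c q c' q'
    assume eq: "insert_front c q = insert_front c' q'"
    have "c = c'"
      using fun_cong[OF eq, of 0] by simp
    moreover have "q k = q' k" for k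
      using fun_cong[OF eq, of "Suc k"] \<open>c = c'\<close> by simp
    ultimately show "c = c' \<and> q = q'"
      by auto
  qed
  have sub: "(\<lambda>(c, q). insert_front c q) ` ?D \<subseteq> {p. p permutes {..<Suc n}}"
    by (auto simp: insert_front_permutes)
  have "card ((\<lambda>(c, q). insert_front c q) ` ?D) = card {p. p permutes {..<Suc n}}"
    by (simp add: card_image[OF inj] card_cartesian_product card_permutations)
  then show ?thesis
    using inj sub by (simp add: bij_betw_def card_subset_eq finite_permutations)
qed

lemma sum_permutations_insert_front:
  fixes g :: "(nat \<Rightarrow> nat) \<Rightarrow> 'b::comm_monoid_add"
  shows "(\<Sum>p | p permutes {..<Suc n}. g p)
    = (\<Sum>c\<le>n. \<Sum>q | q permutes {..<n}. g (insert_front c q))"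
  unfolding sum.cartesian_product sum.reindex_bij_betw[OF bij_betw_insert_front, symmetric]
  by (intro sum.cong) auto

lemma sum_permutations_fixed_front:
  fixes g :: "(nat \<Rightarrow> nat) \<Rightarrow> 'b::comm_monoid_add"
  assumes "c \<le> n"
  shows "(\<Sum>p | p permutes {..<Suc n}. if p 0 = c then g p else 0)
    = (\<Sum>q | q permutes {..<n}. g (insert_front c q))"
proof -
  have "(\<Sum>p | p permutes {..<Suc n}. if p 0 = c then g p else 0)
      = (\<Sum>c'\<le>n. if c' = c then \<Sum>q | q permutes {..<n}. g (insert_front c q) else 0)"
    unfolding sum_permutations_insert_front by (intro sum.cong) auto
  then show ?thesis
    using assms by simp
qed

text \<open>
  Here \<open>insert_front c (\<lambda>k. k)\<close> is the cycle \<open>0 \<mapsto> c\<close>, \<open>k \<mapsto> k - 1\<close> for \<open>1 \<le> k \<le> c\<close>; each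
  increment of \<open>c\<close> composes it with one more adjacent transposition.
\<close>

lemma sign_insert_front_id:
  "permutation (insert_front c (\<lambda>k. k)) \<and> sign (insert_front c (\<lambda>k. k)) = (- 1) ^ c"
proof (induction c)
  case 0
  have "insert_front 0 (\<lambda>k. k) = id"
    by (auto simp: id_def fun_eq_iff insert_front_def skip_def split: nat.splits)
  then show ?case
    by (simp only: permutation_id sign_id power_0 simp_thms)
next
  case (Suc c)
  have step: "insert_front (Suc c) (\<lambda>k. k) = transpose c (Suc c) \<circ> insert_front c (\<lambda>k. k)"
    by (auto simp: fun_eq_iff insert_front_def skip_def Transposition.transpose_def
      split: nat.splits)
  have IH: "permutation (insert_front c (\<lambda>k. k))" "sign (insert_front c (\<lambda>k. k)) = (- 1) ^ c"
    using Suc by simp_all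
  show ?case
    unfolding step sign_compose[OF permutation_swap_id IH(1)] IH(2) sign_swap_id
    by (intro conjI permutation_compose permutation_swap_id IH(1)) simp
qed

lemma sign_insert_front_0:
  assumes "q permutes {..<n}"
  shows "permutation (insert_front 0 q) \<and> sign (insert_front 0 q) = sign q"
  using assms finite_lessThan
proof (induction rule: permutes_induct)
  case id
  then show ?case
    using sign_insert_front_id[of 0] by (simp add: id_def)
next
  case (swap a b p)
  have step: "insert_front 0 (Transposition.transpose a b \<circ> p)
      = Transposition.transpose (Suc a) (Suc b) \<circ> insert_front 0 p"
    by (auto simp: fun_eq_iff insert_front_def skip_def Transposition.transpose_def
      split: nat.splits)
  have IH: "permutation (insert_front 0 p)" "sign (insert_front 0 p) = sign p"
    using swap by simp_all
  have p: "permutation p"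
    using swap by (auto simp: permutation_permutes)
  show ?case
    unfolding step sign_compose[OF permutation_swap_id IH(1)] sign_compose[OF permutation_swap_id p]
      IH(2) sign_swap_id
    by (intro conjI permutation_compose permutation_swap_id IH(1)) simp
qed

lemma sign_insert_front:
  assumes "q permutes {..<n}"
  shows "sign (insert_front c q) = (- 1) ^ c * sign q"
proof -
  \<comment> \<open>First permute the later positions among themselves, then move the value \<open>c\<close> to the front.\<close>
  have "insert_front c q = insert_front c (\<lambda>k. k) \<circ> insert_front 0 q"
    by (auto simp: fun_eq_iff insert_front_def skip_def split: nat.splits)
  then show ?thesis
    using sign_insert_front_id[of c] sign_insert_front_0[OF assms] by (simp add: sign_compose)
qed

section \<open>Expansion of a Pfaffian along a row\<close>

lemma permutation_of_permutes_lessThan: "p permutes {..<n::nat} \<Longrightarrow> permutation p"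
  by (auto simp: permutation_permutes)

definition pf_term :: "nat \<Rightarrow> (nat \<Rightarrow> nat \<Rightarrow> 'b::field) \<Rightarrow> (nat \<Rightarrow> nat) \<Rightarrow> 'b" where
  "pf_term m M p = of_int (sign p) * (\<Prod>k<m. M (p (2 * k)) (p (2 * k + 1)))"

definition pf :: "nat \<Rightarrow> (nat \<Rightarrow> nat \<Rightarrow> 'b::field) \<Rightarrow> 'b" where
  "pf m M = (\<Sum>p | p permutes {..<2 * m}. pf_term m M p) / of_nat (2 ^ m * fact m)"

lemma pfaffian_eq_pf: "pfaffian A = pf (dim_row A div 2) (\<lambda>i j. A $$ (i, j))"
  by (simp add: pfaffian_def pf_def pf_term_def Let_def)

lemma pf_cong:
  assumes "\<And>i j. i < 2 * m \<Longrightarrow> j < 2 * m \<Longrightarrow> M i j = M' i j"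
  shows "pf m M = pf m M'"
proof -
  have "pf_term m M p = pf_term m M' p" if "p permutes {..<2 * m}" for p
    unfolding pf_term_def
  proof (intro arg_cong2[where f = "(*)"] prod.cong refl)
    fix k assume "k \<in> {..<m}"
    then have "p (2 * k) < 2 * m" "p (2 * k + 1) < 2 * m"
      using permutes_in_image[OF that, of "2 * k"] permutes_in_image[OF that, of "2 * k + 1"]
      by simp_all
    then show "M (p (2 * k)) (p (2 * k + 1)) = M' (p (2 * k)) (p (2 * k + 1))"
      by (rule assms)
  qed
  then show ?thesis
    by (simp add: pf_def)
qed

lemma pf_0 [simp]: "pf 0 M = 1"
  by (simp add: pf_def pf_term_def)

text \<open>
  Exchanging the two members of one pair changes the sign of the permutation and, by skew
  symmetry, the sign of one matrix entry.
\<close>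

lemma pf_term_flip_pair:
  fixes M :: "nat \<Rightarrow> nat \<Rightarrow> 'b::field"
  assumes skew: "\<And>i j. M i j = - M j i" and k: "k < m" and p: "p permutes {..<2 * m}"
  shows "pf_term m M (p \<circ> transpose (2 * k) (2 * k + 1)) = pf_term m M p"
proof -
  let ?\<tau> = "Transposition.transpose (2 * k) (2 * k + 1)"
  have sgn: "sign (p \<circ> ?\<tau>) = - sign p"
    using sign_compose[OF permutation_of_permutes_lessThan[OF p] permutation_swap_id]
    by (simp add: sign_swap_id)
  have fix_pair: "?\<tau> (2 * j) = 2 * j" "?\<tau> (2 * j + 1) = 2 * j + 1" if "j \<noteq> k" for j
    using that by (auto simp: Transposition.transpose_def; presburger)+
  have "(\<Prod>j<m. M (p (?\<tau> (2 * j))) (p (?\<tau> (2 * j + 1))))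
      = M (p (2 * k + 1)) (p (2 * k)) * (\<Prod>j\<in>{..<m} - {k}. M (p (2 * j)) (p (2 * j + 1)))"
    using k by (subst prod.remove[of _ k]) (auto simp: fix_pair simp del: add_Suc_right intro!: prod.cong)
  also have "\<dots> = - (M (p (2 * k)) (p (2 * k + 1)) * (\<Prod>j\<in>{..<m} - {k}. M (p (2 * j)) (p (2 * j + 1))))"
    by (subst skew) simp
  also have "\<dots> = - (\<Prod>j<m. M (p (2 * j)) (p (2 * j + 1)))"
    using k by (subst prod.remove[of "{..<m}" k]) auto
  finally show ?thesis
    unfolding pf_term_def sgn by simp
qed

text \<open>
  Exchanging whole pairs is an even permutation that only reorders the factors.
\<close>

lemma pf_term_swap_pairs:
  fixes M :: "nat \<Rightarrow> nat \<Rightarrow> 'b::field"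
  assumes k: "k < m" and p: "p permutes {..<2 * m}"
  shows "pf_term m M (p \<circ> (transpose 0 (2 * k) \<circ> transpose 1 (2 * k + 1))) = pf_term m M p"
proof -
  let ?\<tau> = "Transposition.transpose 0 (2 * k) \<circ> Transposition.transpose 1 (2 * k + 1)"
  let ?\<sigma> = "Transposition.transpose 0 k"
  have "sign ?\<tau> = 1"
    unfolding sign_compose[OF permutation_swap_id permutation_swap_id] by (simp add: sign_swap_id)
  moreover have "permutation ?\<tau>"
    by (intro permutation_compose permutation_swap_id)
  ultimately have sgn: "sign (p \<circ> ?\<tau>) = sign p"
    using sign_compose[OF permutation_of_permutes_lessThan[OF p]] by simp
  have \<tau>: "?\<tau> (2 * j) = 2 * ?\<sigma> j" "?\<tau> (2 * j + 1) = 2 * ?\<sigma> j + 1" for j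
    by (auto simp: Transposition.transpose_def; presburger)+
  have "?\<sigma> permutes {..<m}"
    using k by (intro permutes_swap_id) auto
  then have "(\<Prod>j<m. M (p (2 * j)) (p (2 * j + 1)))
      = (\<Prod>j<m. M (p (2 * ?\<sigma> j)) (p (2 * ?\<sigma> j + 1)))"
    by (subst prod.permute) (auto simp: o_def)
  then show ?thesis
    unfolding pf_term_def sgn comp_apply[of p] \<tau> by simp
qed

text \<open>
  By the two symmetries, all \<open>2 * m\<close> positions at which a permutation may take the value \<open>c\<close>
  contribute equally, so that \<open>c\<close> can be assumed to come first.
\<close>

lemma sum_pf_term_position:
  fixes M :: "nat \<Rightarrow> nat \<Rightarrow> 'b::field"
  assumes skew: "\<And>i j. M i j = - M j i" and l: "l < 2 * m"
  shows "(\<Sum>p | p permutes {..<2 * m}. if p l = c then pf_term m M p else 0)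
    = (\<Sum>p | p permutes {..<2 * m}. if p 0 = c then pf_term m M p else 0)"
proof -
  have move: "(\<Sum>p | p permutes {..<2 * m}. if p l' = c then pf_term m M p else 0)
      = (\<Sum>p | p permutes {..<2 * m}. if p l'' = c then pf_term m M p else 0)"
    if "\<tau> permutes {..<2 * m}" "\<tau> l'' = l'"
      "\<And>p. p permutes {..<2 * m} \<Longrightarrow> pf_term m M (p \<circ> \<tau>) = pf_term m M p" for \<tau> l' l''
    by (subst (2) sum_permutations_compose_right[OF that(1)]) (auto simp: that(2,3) intro: sum.cong)
  define k where "k = l div 2"
  have k: "k < m"
    using l by (simp add: k_def)
  have pair: "(\<Sum>p | p permutes {..<2 * m}. if p (2 * k) = c then pf_term m M p else 0)
      = (\<Sum>p | p permutes {..<2 * m}. if p 0 = c then pf_term m M p else 0)"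
    using k
    by (intro move[of "Transposition.transpose 0 (2 * k) \<circ> Transposition.transpose 1 (2 * k + 1)"]
        pf_term_swap_pairs permutes_compose permutes_swap_id)
      (auto simp: Transposition.transpose_def)
  consider "l = 2 * k" | "l = 2 * k + 1"
    unfolding k_def by linarith
  then show ?thesis
  proof cases
    case 1
    then show ?thesis
      using pair by simp
  next
    case 2
    have "(\<Sum>p | p permutes {..<2 * m}. if p (2 * k + 1) = c then pf_term m M p else 0)
      = (\<Sum>p | p permutes {..<2 * m}. if p (2 * k) = c then pf_term m M p else 0)"
      using k
      by (intro move[of "Transposition.transpose (2 * k) (2 * k + 1)"]
          pf_term_flip_pair[OF skew] permutes_swap_id) auto
    with pair 2 show ?thesis
      by simp
  qed
qed

lemma pf_term_insert_front:
  fixes M :: "nat \<Rightarrow> nat \<Rightarrow> 'b::field"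
  assumes q: "q permutes {..<2 * m}" and i: "i \<le> 2 * m"
  shows "pf_term (Suc m) M (insert_front c (insert_front i q))
    = (- 1) ^ (c + i) * M c (skip c i) * pf_term m (\<lambda>a b. M (skip c (skip i a)) (skip c (skip i b))) q"
proof -
  have "sign (insert_front c (insert_front i q)) = (- 1) ^ (c + i) * sign q"
    using sign_insert_front[OF insert_front_permutes[OF q i]] sign_insert_front[OF q]
    by (simp add: power_add mult.assoc)
  then show ?thesis
    by (simp add: pf_term_def prod.lessThan_Suc_shift mult_ac del: prod.lessThan_Suc)
qed

text \<open>
  Expansion along row \<open>c\<close>.  The index \<open>i\<close> numbers the rows other than \<open>c\<close>, which makes the sign
  \<open>(- 1) ^ (c + i)\<close> uniform, without a case distinction between \<open>skip c i < c\<close> and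
  \<open>skip c i > c\<close>.
\<close>

lemma pf_expand:
  fixes M :: "nat \<Rightarrow> nat \<Rightarrow> 'b::field_char_0"
  assumes skew: "\<And>i j. M i j = - M j i" and c: "c < 2 * Suc m"
  shows "pf (Suc m) M = (\<Sum>i\<le>2 * m. (- 1) ^ (c + i) * M c (skip c i)
    * pf m (\<lambda>a b. M (skip c (skip i a)) (skip c (skip i b))))"
proof -
  let ?Perms = "\<lambda>k. {p. p permutes {..<k}}"
  let ?minor = "\<lambda>i a b. M (skip c (skip i a)) (skip c (skip i b))"
  \<comment> \<open>Each permutation takes the value \<open>c\<close> at exactly one position.\<close>
  have "sum (pf_term (Suc m) M) (?Perms (2 * Suc m))
      = (\<Sum>p\<in>?Perms (2 * Suc m). \<Sum>l<2 * Suc m. if p l = c then pf_term (Suc m) M p else 0)"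
  proof (rule sum.cong)
    fix p assume "p \<in> ?Perms (2 * Suc m)"
    then have p: "p permutes {..<2 * Suc m}"
      by simp
    have "inv_into UNIV p c < 2 * Suc m"
      using permutes_in_image[OF permutes_inv[OF p], of c] c by simp
    moreover have "p l = c \<longleftrightarrow> l = inv_into UNIV p c" for l
      using permutes_inv_eq[OF p, of c l] by (simp only: eq_commute)
    ultimately show "pf_term (Suc m) M p
        = (\<Sum>l<2 * Suc m. if p l = c then pf_term (Suc m) M p else 0)"
      by (simp only: sum.delta finite_lessThan lessThan_iff if_True)
  qed simp
  also have "\<dots> = (\<Sum>l<2 * Suc m. \<Sum>p\<in>?Perms (2 * Suc m). if p 0 = c then pf_term (Suc m) M p else 0)"
    unfolding sum.swap[of _ _ "?Perms (2 * Suc m)"]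
    by (intro sum.cong refl sum_pf_term_position[OF skew]) simp
  also have "\<dots> = of_nat (2 * Suc m)
      * (\<Sum>p\<in>?Perms (Suc (2 * m + 1)). if p 0 = c then pf_term (Suc m) M p else 0)"
    by (simp del: lessThan_Suc)
  also have "(\<Sum>p\<in>?Perms (Suc (2 * m + 1)). if p 0 = c then pf_term (Suc m) M p else 0)
      = (\<Sum>q\<in>?Perms (Suc (2 * m)). pf_term (Suc m) M (insert_front c q))"
    using c by (subst sum_permutations_fixed_front) simp_all
  also have "\<dots> = (\<Sum>i\<le>2 * m. \<Sum>q\<in>?Perms (2 * m). (- 1) ^ (c + i) * M c (skip c i)
      * pf_term m (?minor i) q)"
    unfolding sum_permutations_insert_front
    by (intro sum.cong refl pf_term_insert_front) auto
  finally have total: "sum (pf_term (Suc m) M) (?Perms (2 * Suc m)) = of_nat (2 * Suc m) * \<dots>" .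
  have norm: "2 ^ Suc m * fact (Suc m) = 2 * Suc m * (2 ^ m * fact m)"
    by (simp add: algebra_simps)
  show ?thesis
    unfolding pf_def total norm of_nat_mult[of "2 * Suc m"]
    by (subst mult_divide_mult_cancel_left)
      (simp_all only: of_nat_eq_0_iff sum_distrib_left sum_divide_distrib times_divide_eq_right, simp)
qed

section \<open>Partial fraction identities\<close>

lemma poly_eq_0_of_roots:
  fixes p :: "'b::idom poly"
  assumes "finite S" "\<And>a. a \<in> S \<Longrightarrow> poly p a = 0" "degree p < card S"
  shows "p = 0"
proof (rule ccontr)
  assume p: "p \<noteq> 0"
  then have "card S \<le> card {a. poly p a = 0}"
    using assms(2) by (intro card_mono poly_roots_finite) auto
  also have "\<dots> \<le> degree p"
    using p by (rule card_poly_roots_bound)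
  finally show False
    using assms(3) by simp
qed

text \<open>
  The coefficient comparison in Lagrange's interpolation formula: \<open>F\<close> is the combination of
  the monic polynomials \<open>L a\<close> of degree \<open>card S - 1\<close>, where \<open>L a\<close> vanishes on \<open>S - {a}\<close>.
\<close>

lemma lagrange_leading_coeff:
  fixes F :: "'b::field poly"
  assumes S: "finite S" and deg: "degree F < card S"
  shows "(\<Sum>a\<in>S. poly F a / (\<Prod>b\<in>S - {a}. a - b)) = coeff F (card S - 1)"
proof -
  define L where "L a = (\<Prod>b\<in>S - {a}. [:- b, 1:])" for a
  have L_deg: "degree (L a) = card S - 1" and L_lead: "coeff (L a) (card S - 1) = 1"
    if "a \<in> S" for a
  proof -
    show *: "degree (L a) = card S - 1"
      unfolding L_def using S that by (subst degree_prod_eq_sum_degree) auto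
    have "lead_coeff (L a) = 1"
      unfolding L_def by (simp add: lead_coeff_prod)
    then show "coeff (L a) (card S - 1) = 1"
      using * by simp
  qed
  define c where "c a = poly F a / (\<Prod>b\<in>S - {a}. a - b)" for a
  define G where "G = (\<Sum>a\<in>S. Polynomial.smult (c a) (L a))"
  have "F - G = 0"
  proof (rule poly_eq_0_of_roots[OF S])
    fix a assume a: "a \<in> S"
    have "poly (L b) a = 0" if "b \<in> S - {a}" for b
      unfolding L_def poly_prod using S a that by (intro prod_zero) auto
    then have "poly G a = c a * poly (L a) a"
      unfolding G_def poly_sum using S a by (simp add: sum.remove)
    also have "\<dots> = poly F a"
      using S by (simp add: c_def L_def poly_prod)
    finally show "poly (F - G) a = 0"
      by simp
  next
    have "degree (Polynomial.smult (c a) (L a)) \<le> card S - 1" if "a \<in> S" for a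
      using degree_smult_le[of "c a" "L a"] L_deg[OF that] by simp
    then have "degree G \<le> card S - 1"
      unfolding G_def by (intro degree_sum_le S) auto
    then show "degree (F - G) < card S"
      using deg by (intro degree_diff_less) auto
  qed
  then have "coeff F (card S - 1) = coeff G (card S - 1)"
    by simp
  also have "\<dots> = (\<Sum>a\<in>S. c a)"
    unfolding G_def coeff_sum by (intro sum.cong) (simp_all add: L_lead[simplified])
  finally show ?thesis
    by (simp add: c_def)
qed

text \<open>
  Interpolate the product of the factors \<open>z - t * x j\<close> at the points \<open>x i\<close> and \<open>0\<close>.  The factor \<open>j = i\<close>
  gives \<open>(1 - t) * x i\<close> at \<open>x i\<close>, and the point \<open>0\<close> contributes \<open>t ^ n\<close>.
\<close>

lemma sum_symmetric_factors:
  fixes x :: "nat \<Rightarrow> 'b::field"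
  assumes inj: "inj_on x {..<n}" and nz: "\<And>i. i < n \<Longrightarrow> x i \<noteq> 0"
  shows "(1 - t) * (\<Sum>i<n. \<Prod>j\<in>{..<n} - {i}. (x i - t * x j) / (x i - x j)) = 1 - t ^ n"
proof -
  define F where "F = (\<Prod>j<n. [:- (t * x j), 1:])"
  let ?S = "insert 0 (x ` {..<n})"
  have 0: "0 \<notin> x ` {..<n}"
    using nz by force
  have card: "card ?S = Suc n"
    using 0 by (simp add: card_image[OF inj])
  have F_deg: "degree F = n"
    unfolding F_def by (subst degree_prod_eq_sum_degree) auto
  have "lead_coeff F = 1"
    unfolding F_def by (simp add: lead_coeff_prod)
  then have F_lead: "coeff F n = 1"
    using F_deg by simp
  have "(\<Sum>a\<in>?S. poly F a / (\<Prod>b\<in>?S - {a}. a - b)) = 1"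
    using lagrange_leading_coeff[of ?S F] by (simp add: card F_deg F_lead)
  also have "(\<Sum>a\<in>?S. poly F a / (\<Prod>b\<in>?S - {a}. a - b))
      = poly F 0 / (\<Prod>b\<in>x ` {..<n}. - b) + (\<Sum>i<n. poly F (x i) / (\<Prod>b\<in>?S - {x i}. x i - b))"
    using 0 by (simp add: sum.reindex[OF inj])
  also have "poly F 0 / (\<Prod>b\<in>x ` {..<n}. - b) = t ^ n"
  proof -
    have "poly F 0 = (\<Prod>j<n. t * - x j)"
      by (simp add: F_def poly_prod)
    also have "\<dots> = t ^ n * (\<Prod>j<n. - x j)"
      unfolding prod.distrib by simp
    moreover have "(\<Prod>j<n. - x j) \<noteq> 0"
      using nz by simp
    ultimately show ?thesis
      by (simp add: prod.reindex[OF inj] o_def)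
  qed
  also have "(\<Sum>i<n. poly F (x i) / (\<Prod>b\<in>?S - {x i}. x i - b))
      = (\<Sum>i<n. (1 - t) * (\<Prod>j\<in>{..<n} - {i}. (x i - t * x j) / (x i - x j)))"
  proof (rule sum.cong)
    fix i assume "i \<in> {..<n}"
    then have i: "i < n" "x i \<noteq> 0"
      using nz by auto
    have "?S - {x i} = insert 0 (x ` ({..<n} - {i}))"
      using i inj by (auto simp: inj_on_def)
    moreover have "0 \<notin> x ` ({..<n} - {i})"
      using 0 by blast
    ultimately have "(\<Prod>b\<in>?S - {x i}. x i - b) = x i * (\<Prod>j\<in>{..<n} - {i}. x i - x j)"
      by (simp add: prod.reindex[OF inj_on_subset[OF inj]])
    moreover have "poly F (x i) = (1 - t) * x i * (\<Prod>j\<in>{..<n} - {i}. x i - t * x j)"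
      using i by (simp add: F_def poly_prod prod.remove[of "{..<n}" i] algebra_simps)
    ultimately show "poly F (x i) / (\<Prod>b\<in>?S - {x i}. x i - b)
        = (1 - t) * (\<Prod>j\<in>{..<n} - {i}. (x i - t * x j) / (x i - x j))"
      using i by (simp add: prod_dividef)
  qed simp
  finally show ?thesis
    by (simp add: sum_distrib_left algebra_simps)
qed

text \<open>
  This is the expansion of Schur's Pfaffian along the row of the variable \<open>y\<close>, after division
  by \<open>Delta\<close> of the other variables.  It results from interpolating
  \<open>(y - z) * (\<Prod>j<m. z + x j)\<close> at the points \<open>x i\<close>, \<open>0\<close> and \<open>- y\<close>; for odd \<open>m\<close> the point
  \<open>0\<close> contributes \<open>- 1\<close>, which cancels the leading coefficient.
\<close>

lemma sum_schur_partial_fractions: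
  fixes x :: "nat \<Rightarrow> 'b::field"
  assumes inj: "inj_on x {..<m}" and nz: "\<And>i. i < m \<Longrightarrow> x i \<noteq> 0"
    and y: "y \<noteq> 0" "\<And>i. i < m \<Longrightarrow> y + x i \<noteq> 0"
    and two: "(2 :: 'b) \<noteq> 0" and odd: "odd m"
  shows "(\<Sum>i<m. (y - x i) / (y + x i) * (\<Prod>j\<in>{..<m} - {i}. (x i + x j) / (x i - x j)))
    = (\<Prod>j<m. (y - x j) / (y + x j))"
proof -
  define F where "F = [:y, -1:] * (\<Prod>j<m. [:x j, 1:])"
  let ?S = "insert (- y) (insert 0 (x ` {..<m}))"
  have 0: "0 \<notin> x ` {..<m}" and y': "- y \<notin> insert 0 (x ` {..<m})" 
    using nz y by (force simp: add_eq_0_iff)+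
  have card: "card ?S = Suc (Suc m)"
    using 0 y' by (simp add: card_image[OF inj])
  have prod_deg: "degree (\<Prod>j<m. [:x j, 1:]) = m"
    by (subst degree_prod_eq_sum_degree) auto
  have F_deg: "degree F = Suc m"
    unfolding F_def by (subst degree_mult_eq) (auto simp: prod_deg)
  have "lead_coeff F = -1"
    unfolding F_def lead_coeff_mult lead_coeff_prod by simp
  then have F_lead: "coeff F (Suc m) = -1"
    using F_deg by simp
  have ev: "poly F z = (y - z) * (\<Prod>j<m. z + x j)" for z
    by (simp add: F_def poly_prod algebra_simps)
  have P_nz: "(\<Prod>j<m. x j) \<noteq> 0" "(\<Prod>j<m. y + x j) \<noteq> 0"
    using nz y by auto
  have sum_split: "(\<Sum>a\<in>?S. g a) = g (- y) + g 0 + (\<Sum>i<m. g (x i))" for g :: "'b \<Rightarrow> 'b"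
    using 0 y' by (simp add: sum.reindex[OF inj] add.assoc)
  have "(\<Sum>a\<in>?S. poly F a / (\<Prod>b\<in>?S - {a}. a - b)) = -1"
    using lagrange_leading_coeff[of ?S F] by (simp add: card F_deg F_lead)
  also have "(\<Sum>a\<in>?S. poly F a / (\<Prod>b\<in>?S - {a}. a - b))
      = poly F (- y) / (\<Prod>b\<in>?S - {- y}. - y - b) + poly F 0 / (\<Prod>b\<in>?S - {0}. 0 - b)
        + (\<Sum>i<m. poly F (x i) / (\<Prod>b\<in>?S - {x i}. x i - b))"
    by (rule sum_split)
  also have "poly F (- y) / (\<Prod>b\<in>?S - {- y}. - y - b) = - 2 * (\<Prod>j<m. (y - x j) / (y + x j))"
  proof -
    have "?S - {- y} = insert 0 (x ` {..<m})"
      using y' by auto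
    moreover have "(\<Prod>j<m. - y - x j) = - (\<Prod>j<m. y + x j)"
      using odd prod_uminus[of "\<lambda>j. y + x j" "{..<m}"] by (simp add: algebra_simps)
    moreover have "(\<Prod>j<m. - y + x j) = - (\<Prod>j<m. y - x j)"
      using odd prod_uminus[of "\<lambda>j. y - x j" "{..<m}"] by (simp add: algebra_simps)
    ultimately show ?thesis
      using 0 y P_nz by (simp add: ev prod.reindex[OF inj] prod_dividef o_def)
  qed
  also have "poly F 0 / (\<Prod>b\<in>?S - {0}. 0 - b) = -1"
  proof -
    have "?S - {0} = insert (- y) (x ` {..<m})"
      using 0 y by auto
    moreover have "(\<Prod>j<m. - x j) = - (\<Prod>j<m. x j)"
      using odd prod_uminus[of x "{..<m}"] by simp
    ultimately show ?thesis
      using y y' P_nz by (simp add: ev prod.reindex[OF inj] o_def)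
  qed
  also have "(\<Sum>i<m. poly F (x i) / (\<Prod>b\<in>?S - {x i}. x i - b))
      = (\<Sum>i<m. 2 * ((y - x i) / (y + x i) * (\<Prod>j\<in>{..<m} - {i}. (x i + x j) / (x i - x j))))"
  proof (rule sum.cong)
    fix i assume "i \<in> {..<m}"
    then have i: "i < m" "x i \<noteq> 0" "y + x i \<noteq> 0"
      using nz y by auto
    have "?S - {x i} = insert (- y) (insert 0 (x ` ({..<m} - {i})))"
      using i inj y' by (auto simp: inj_on_def)
    moreover have "0 \<notin> x ` ({..<m} - {i})" "- y \<notin> insert 0 (x ` ({..<m} - {i}))"
      using 0 y' by blast+
    ultimately have "(\<Prod>b\<in>?S - {x i}. x i - b)
        = (y + x i) * x i * (\<Prod>j\<in>{..<m} - {i}. x i - x j)"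
      by (simp add: prod.reindex[OF inj_on_subset[OF inj]] algebra_simps)
    moreover have "poly F (x i) = 2 * x i * (y - x i) * (\<Prod>j\<in>{..<m} - {i}. x i + x j)"
      using i by (simp add: ev prod.remove[of "{..<m}" i] algebra_simps)
    ultimately show "poly F (x i) / (\<Prod>b\<in>?S - {x i}. x i - b)
        = 2 * ((y - x i) / (y + x i) * (\<Prod>j\<in>{..<m} - {i}. (x i + x j) / (x i - x j)))"
      using i by (simp add: prod_dividef)
  qed simp
  finally have "2 * (\<Sum>i<m. (y - x i) / (y + x i) * (\<Prod>j\<in>{..<m} - {i}. (x i + x j) / (x i - x j)))
      = 2 * (\<Prod>j<m. (y - x j) / (y + x j))"
    by (simp add: sum_distrib_left algebra_simps)
  then show ?thesis
    using two by simp
qed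

section \<open>The Hall--Littlewood sum for general t\<close>

primrec hl_rec :: "(nat \<Rightarrow> 'b::field poly) \<Rightarrow> 'b \<Rightarrow> nat list \<Rightarrow> nat \<Rightarrow> (nat \<Rightarrow> 'b) \<Rightarrow> 'b" where
  "hl_rec f t [] n x = 1"
| "hl_rec f t (k # ks) n x = (\<Sum>i<n. poly (f k) (x i)
     * (\<Prod>j\<in>{..<n} - {i}. (x i - t * x j) / (x i - x j))
     * hl_rec f t ks (n - 1) (\<lambda>j. x (skip i j)))"

definition hl_sum :: "(nat \<Rightarrow> 'b::field poly) \<Rightarrow> 'b \<Rightarrow> nat list \<Rightarrow> nat \<Rightarrow> (nat \<Rightarrow> 'b) \<Rightarrow> 'b" where
  "hl_sum f t lam n x = (\<Sum>w | w permutes {..<n}. HL_term f n lam (\<lambda>i. x (w i)) t)"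

text \<open>
  The permuted product splits into the factors with the first variable \<open>x i\<close>, whose product
  no longer depends on \<open>q\<close>, and the summand for the other variables.
\<close>

lemma HL_term_insert_front:
  fixes x :: "nat \<Rightarrow> 'b::field"
  assumes pad: "pad (Suc n) lam = k # pad n ks" and q: "q permutes {..<n}" and i: "i \<le> n"
  shows "HL_term f (Suc n) lam (\<lambda>l. x (insert_front i q l)) t
    = poly (f k) (x i) * (\<Prod>j\<in>{..<Suc n} - {i}. (x i - t * x j) / (x i - x j))
      * HL_term f n ks (\<lambda>l. x (skip i (q l))) t"
proof -
  let ?h = "\<lambda>a b. (a - t * b) / (a - b)"
  have "(\<Prod>l<n. ?h (x i) (x (skip i (q l)))) = (\<Prod>l<n. ?h (x i) (x (skip i l)))"
    using prod.permute[OF q, of "\<lambda>l. ?h (x i) (x (skip i l))"] by (simp add: o_def)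
  also have "\<dots> = (\<Prod>j\<in>{..<Suc n} - {i}. ?h (x i) (x j))"
    by (rule prod_skip[OF i])
  finally have row: "(\<Prod>l<n. ?h (x i) (x (skip i (q l)))) = (\<Prod>j\<in>{..<Suc n} - {i}. ?h (x i) (x j))" .
  show ?thesis
    unfolding HL_term_def pad prod.lessThan_Suc_shift insert_front_0 insert_front_Suc
      nth_Cons_0 nth_Cons_Suc prod.distrib row
    by (simp only: lessThan_0 prod.empty mult_1_left mult_ac)
qed

text \<open>
  The hypothesis about \<open>pad\<close> covers two cases at once: \<open>lam = k # ks\<close>, and \<open>lam = ks = []\<close> with
  \<open>k = 0\<close>.
\<close>

lemma hl_sum_Suc:
  fixes x :: "nat \<Rightarrow> 'b::field"
  assumes "pad (Suc n) lam = k # pad n ks"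
  shows "hl_sum f t lam (Suc n) x = (\<Sum>i<Suc n. poly (f k) (x i)
    * (\<Prod>j\<in>{..<Suc n} - {i}. (x i - t * x j) / (x i - x j))
    * hl_sum f t ks n (\<lambda>j. x (skip i j)))"
  unfolding hl_sum_def sum_permutations_insert_front lessThan_Suc_atMost[symmetric] sum_distrib_left
  by (intro sum.cong refl HL_term_insert_front assms) auto

lemma q_fact_Suc: "q_fact t (Suc n) = q_fact t n * ((1 - t ^ Suc n) / (1 - t))"
  by (simp add: q_fact_def)

lemma inj_on_comp_skip:
  assumes "inj_on x {..<Suc n}"
  shows "inj_on (\<lambda>j. x (skip i j)) {..<n}"
proof (rule inj_onI)
  fix a b assume "a \<in> {..<n}" "b \<in> {..<n}" "x (skip i a) = x (skip i b)"
  then have "skip i a = skip i b"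
    by (intro inj_onD[OF assms]) (simp_all add: skip_less del: lessThan_Suc)
  then show "a = b"
    by simp
qed

lemma hl_sum_Nil:
  fixes x :: "nat \<Rightarrow> 'b::field"
  assumes f0: "f 0 = 1" and t: "t \<noteq> 1"
    and "inj_on x {..<n}" "\<And>i. i < n \<Longrightarrow> x i \<noteq> 0"
  shows "hl_sum f t [] n x = q_fact t n"
  using assms(3,4)
proof (induction n arbitrary: x)
  case 0
  then show ?case
    by (simp add: hl_sum_def HL_term_def q_fact_def)
next
  case (Suc n)
  let ?c = "\<lambda>i. \<Prod>j\<in>{..<Suc n} - {i}. (x i - t * x j) / (x i - x j)"
  have "hl_sum f t [] (Suc n) x
      = (\<Sum>i<Suc n. poly (f 0) (x i) * ?c i * hl_sum f t [] n (\<lambda>j. x (skip i j)))"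
    by (rule hl_sum_Suc) (simp add: pad_def)
  also have "\<dots> = (\<Sum>i<Suc n. ?c i * q_fact t n)"
  proof (rule sum.cong)
    fix i
    have "hl_sum f t [] n (\<lambda>j. x (skip i j)) = q_fact t n"
      using Suc.prems by (intro Suc.IH inj_on_comp_skip) (simp_all add: skip_less)
    then show "poly (f 0) (x i) * ?c i * hl_sum f t [] n (\<lambda>j. x (skip i j)) = ?c i * q_fact t n"
      by (simp only: f0 poly_1 mult_1_left)
  qed simp
  also have "\<dots> = (\<Sum>i<Suc n. ?c i) * q_fact t n"
    by (simp only: sum_distrib_right)
  also have "(\<Sum>i<Suc n. ?c i) = (1 - t ^ Suc n) / (1 - t)"
    using sum_symmetric_factors[OF Suc.prems, of t] t
    by (simp only: eq_divide_eq right_minus_eq mult.commute) simp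
  finally show ?case
    by (simp only: q_fact_Suc mult.commute)
qed

text \<open>
  After all parts of \<open>lam\<close> have been removed, \<open>n - length lam\<close> variables with the part \<open>0\<close>
  remain in every summand, and they contribute the same factor.
\<close>

lemma hl_sum_eq_hl_rec:
  fixes x :: "nat \<Rightarrow> 'b::field"
  assumes f0: "f 0 = 1" and t: "t \<noteq> 1"
    and "length lam \<le> n" "inj_on x {..<n}" "\<And>i. i < n \<Longrightarrow> x i \<noteq> 0"
  shows "hl_sum f t lam n x = q_fact t (n - length lam) * hl_rec f t lam n x"
  using assms(3-5)
proof (induction lam arbitrary: n x)
  case Nil
  then show ?case
    using hl_sum_Nil[of f t x n] f0 t by simp
next
  case (Cons k ks)
  from Cons.prems(1) obtain n' where n: "n = Suc n'"
    by (cases n) auto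
  have "hl_sum f t ks n' (\<lambda>j. x (skip i j))
      = q_fact t (n' - length ks) * hl_rec f t ks n' (\<lambda>j. x (skip i j))" for i
    using Cons.prems unfolding n
    by (intro Cons.IH inj_on_comp_skip) (simp_all add: skip_less)
  then have "hl_sum f t (k # ks) n x = (\<Sum>i<n. poly (f k) (x i)
      * (\<Prod>j\<in>{..<n} - {i}. (x i - t * x j) / (x i - x j))
      * (q_fact t (n' - length ks) * hl_rec f t ks n' (\<lambda>j. x (skip i j))))"
    unfolding n by (subst hl_sum_Suc[of _ _ k ks]) (simp_all add: pad_def del: lessThan_Suc sum.lessThan_Suc)
  then show ?case
    by (simp add: n sum_distrib_left mult_ac del: lessThan_Suc sum.lessThan_Suc)
qed

lemma count_list_distinct: "distinct xs \<Longrightarrow> count_list xs k = (if k \<in> set xs then 1 else 0)"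
  by (induction xs) auto

lemma count_list_replicate: "count_list (replicate m k) k = m"
  by (induction m) auto

lemma distinct_of_sorted_greater:
  fixes xs :: "'c::preorder list"
  shows "sorted_wrt (>) xs \<Longrightarrow> distinct xs"
  by (induction xs) auto

text \<open>
  The parts of a strict partition occur once each; only the appended zeros are repeated.
\<close>

lemma v_coeff_strict_partition:
  fixes t :: "'b::field"
  assumes lam: "strict_partition lam" and t: "t \<noteq> 1"
  shows "v_coeff n lam t = q_fact t (n - length lam)"
proof -
  have "distinct lam"
    using lam by (simp add: strict_partition_def distinct_of_sorted_greater)
  have 0: "0 \<notin> set lam"
    using lam by (auto simp: strict_partition_def)
  have 1: "q_fact t (Suc 0) = 1"
    using t by (simp add: q_fact_def)
  have cnt: "count_list (pad n lam) k = (if k = 0 then n - length lam else 1)" if "k \<in> set (pad n lam)" for k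
    using that 0 \<open>distinct lam\<close> by (auto simp: pad_def count_list_distinct count_list_replicate)
  have "v_coeff n lam t = (\<Prod>k\<in>set (pad n lam). if k = 0 then q_fact t (n - length lam) else 1)"
    unfolding v_coeff_def by (intro prod.cong) (auto simp: cnt 1)
  also have "\<dots> = q_fact t (n - length lam)"
    using 0 by (auto simp: pad_def q_fact_def)
  finally show ?thesis .
qed

lemma HL_at_eq_hl_rec:
  fixes x :: "nat \<Rightarrow> 'b::field"
  assumes "f 0 = 1" and t: "t \<noteq> 1" "\<And>m. q_fact t m \<noteq> 0"
    and lam: "strict_partition lam" "length lam \<le> n"
    and x: "inj_on x {..<n}" "\<And>i. i < n \<Longrightarrow> x i \<noteq> 0"
  shows "HL_at f n lam x t = hl_rec f t lam n x"
  unfolding HL_at_def hl_sum_def[symmetric]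
  using hl_sum_eq_hl_rec[of f t lam n x] v_coeff_strict_partition[of lam t n] assms by simp

section \<open>Pfaffians of the block matrices\<close>

text \<open>
  The case \<open>i = j\<close> is included on purpose: it makes all \<open>x i\<close> nonzero.
\<close>

definition generic :: "nat \<Rightarrow> (nat \<Rightarrow> 'b::field) \<Rightarrow> bool" where
  "generic n x \<longleftrightarrow> inj_on x {..<n} \<and> (\<forall>i<n. \<forall>j<n. x i + x j \<noteq> 0)"

lemma generic_skip: "generic (Suc n) x \<Longrightarrow> generic n (\<lambda>j. x (skip i j))"
  by (simp add: generic_def skip_less inj_on_comp_skip)

lemma generic_Suc_D: "generic (Suc n) x \<Longrightarrow> generic n x"
  by (auto simp: generic_def inj_on_def)

lemma generic_nonzero: "generic n x \<Longrightarrow> i < n \<Longrightarrow> x i \<noteq> 0"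
  by (fastforce simp: generic_def)

lemma Delta_Suc: "Delta (Suc n) x = Delta n x * (\<Prod>i<n. (x n - x i) / (x n + x i))"
  by (simp add: Delta_def)

lemma Delta_nonzero: "generic n x \<Longrightarrow> Delta n x \<noteq> 0"
  by (auto simp: Delta_def generic_def inj_on_eq_iff)

text \<open>
  The sign counts the \<open>n - i\<close> factors with \<open>j > i\<close>, in which \<open>x i\<close> stands on the other side
  of the difference.
\<close>

lemma Delta_skip:
  fixes x :: "nat \<Rightarrow> 'b::field"
  assumes "i \<le> n"
  shows "Delta (Suc n) x = (- 1) ^ (n + i) * Delta n (\<lambda>j. x (skip i j))
    * (\<Prod>j\<in>{..<Suc n} - {i}. (x i - x j) / (x i + x j))"
  using assms
proof (induction n)
  case 0
  then show ?case
    by (simp add: Delta_def)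
next
  case (Suc n)
  let ?h = "\<lambda>a b. (x a - x b) / (x a + x b)"
  show ?case
  proof (cases "i = Suc n")
    case True
    have "Delta (Suc n) (\<lambda>j. x (skip (Suc n) j)) = Delta (Suc n) x"
      unfolding Delta_def by (intro prod.cong) (auto simp: skip_def)
    moreover have "{..<Suc (Suc n)} - {Suc n} = {..<Suc n}"
      by auto
    ultimately show ?thesis
      unfolding True Delta_Suc[of "Suc n"] by simp
  next
    case False
    with Suc.prems have i: "i \<le> n"
      by simp
    have anti: "?h (Suc n) i = - ?h i (Suc n)"
      by (simp add: minus_divide_left add.commute)
    have row: "(\<Prod>j<Suc n. ?h (Suc n) j) = ?h (Suc n) i * (\<Prod>j<n. ?h (Suc n) (skip i j))"
      using prod_skip[OF i, of "?h (Suc n)"] i by (simp only: prod.remove[of "{..<Suc n}" i] finite_lessThan lessThan_iff less_Suc_eq_le)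
    have "{..<Suc (Suc n)} - {i} = insert (Suc n) ({..<Suc n} - {i})"
      using i by auto
    then have col: "(\<Prod>j\<in>{..<Suc (Suc n)} - {i}. ?h i j)
        = ?h i (Suc n) * (\<Prod>j\<in>{..<Suc n} - {i}. ?h i j)"
      by (simp del: lessThan_Suc)
    have minor: "Delta (Suc n) (\<lambda>j. x (skip i j))
        = Delta n (\<lambda>j. x (skip i j)) * (\<Prod>j<n. ?h (Suc n) (skip i j))"
      using i unfolding Delta_Suc by (simp add: skip_def)
    show ?thesis
      unfolding Delta_Suc[of "Suc n"] row col minor Suc.IH[OF i] anti by simp
  qed
qed

text \<open>
  The entries of the block matrix, extended to all indices so that skew symmetry and the passage to
  minors hold without bounds.
\<close>

definition P_entry :: "(nat \<Rightarrow> 'b::field poly) \<Rightarrow> nat \<Rightarrow> nat list \<Rightarrow> (nat \<Rightarrow> 'b) \<Rightarrow> nat \<Rightarrow> nat \<Rightarrow> 'b" where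
  "P_entry f n \<mu> x i j =
     (if i < n then if j < n then (x j - x i) / (x j + x i) else poly (f (\<mu> ! (j - n))) (x i)
      else if j < n then - poly (f (\<mu> ! (i - n))) (x j) else 0)"

definition P_quot :: "(nat \<Rightarrow> 'b::field poly) \<Rightarrow> nat \<Rightarrow> nat list \<Rightarrow> (nat \<Rightarrow> 'b) \<Rightarrow> 'b" where
  "P_quot f n \<mu> x = pf ((n + length \<mu>) div 2) (P_entry f n \<mu> x) / Delta n x"

lemma P_at_eq_P_quot:
  assumes "even (n + length (star_partition n lam))"
  shows "P_at f n lam x = P_quot f n (star_partition n lam) x"
proof -
  define \<mu> where "\<mu> = star_partition n lam"
  have "pf ((n + length \<mu>) div 2) (\<lambda>i j. four_block_mat (matA n x) (matV f n \<mu> x)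
      (- transpose_mat (matV f n \<mu> x)) (0\<^sub>m (length \<mu>) (length \<mu>)) $$ (i, j))
    = pf ((n + length \<mu>) div 2) (P_entry f n \<mu> x)"
    by (intro pf_cong) (auto simp: P_entry_def matA_def matV_def)
  then show ?thesis
    by (simp add: P_at_def P_quot_def pfaffian_eq_pf Let_def \<mu>_def matA_def matV_def)
qed

lemma P_entry_skew: "P_entry f n \<mu> x i j = - P_entry f n \<mu> x j i"
  by (simp add: P_entry_def minus_divide_left add.commute)

text \<open>
  Row number \<open>Suc n\<close>, the first one below the block \<open>A\<close>, has the entries \<open>- f k (x i)\<close> in the
  first \<open>Suc n\<close> columns and zeros elsewhere.  Deleting it together with row \<open>i\<close> removes the part
  \<open>k\<close> and the variable \<open>x i\<close>.
\<close>

lemma P_quot_Cons: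
  fixes x :: "nat \<Rightarrow> 'b::field_char_0"
  assumes even: "even (n + length ks)"
  shows "P_quot f (Suc n) (k # ks) x = (\<Sum>i<Suc n. poly (f k) (x i)
    * (\<Prod>j\<in>{..<Suc n} - {i}. (x i + x j) / (x i - x j)) * P_quot f n ks (\<lambda>j. x (skip i j)))"
proof -
  obtain m where m: "n + length ks = 2 * m"
    using even by blast
  let ?M = "P_entry f (Suc n) (k # ks) x"
  let ?N = "\<lambda>i. P_entry f n ks (\<lambda>j. x (skip i j))"
  have minor: "?M (skip (Suc n) (skip i a)) (skip (Suc n) (skip i b)) = ?N i a b" if "i < Suc n" for i a b
  proof -
    have small: "skip (Suc n) (skip i a) = skip i a \<and> skip i a < Suc n" if "a < n" for a
      using that by (auto simp: skip_def)
    have large: "skip (Suc n) (skip i a) = Suc (Suc a) \<and> Suc (Suc a) - Suc n = Suc (a - n)" if "\<not> a < n" for a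
      using that \<open>i < Suc n\<close> by (auto simp: skip_def)
    show ?thesis
      using small[of a] small[of b] large[of a] large[of b]
      by (cases "a < n"; cases "b < n") (simp_all add: P_entry_def)
  qed
  have "pf (Suc m) ?M = (\<Sum>i\<le>2 * m. (- 1) ^ (Suc n + i) * ?M (Suc n) (skip (Suc n) i)
      * pf m (\<lambda>a b. ?M (skip (Suc n) (skip i a)) (skip (Suc n) (skip i b))))"
    using m by (intro pf_expand P_entry_skew) auto
  also have "\<dots> = (\<Sum>i<Suc n. (- 1) ^ (Suc n + i) * ?M (Suc n) (skip (Suc n) i)
      * pf m (\<lambda>a b. ?M (skip (Suc n) (skip i a)) (skip (Suc n) (skip i b))))"
    using m by (intro sum.mono_neutral_right) (auto simp: P_entry_def skip_def)
  also have "\<dots> = (\<Sum>i<Suc n. (- 1) ^ (n + i) * poly (f k) (x i) * pf m (?N i))"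
    by (intro sum.cong refl) (simp add: minor del: lessThan_Suc, simp add: P_entry_def skip_def)
  finally have pf: "pf (Suc m) ?M = (\<Sum>i<Suc n. (- 1) ^ (n + i) * poly (f k) (x i) * pf m (?N i))" .
  have deg: "(Suc n + length (k # ks)) div 2 = Suc m" "(n + length ks) div 2 = m"
    using m by simp_all
  have inv: "inverse (\<Prod>j\<in>A. (x i - x j) / (x i + x j)) = (\<Prod>j\<in>A. (x i + x j) / (x i - x j))" for A i
    by (simp add: prod_inversef[symmetric])
  show ?thesis
    unfolding P_quot_def deg pf sum_divide_distrib
  proof (intro sum.cong refl)
    fix i assume "i \<in> {..<Suc n}"
    then have i: "i \<le> n"
      by simp
    show "(- 1) ^ (n + i) * poly (f k) (x i) * pf m (?N i) / Delta (Suc n) x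
        = poly (f k) (x i) * (\<Prod>j\<in>{..<Suc n} - {i}. (x i + x j) / (x i - x j))
          * (pf m (?N i) / Delta n (\<lambda>j. x (skip i j)))"
      unfolding Delta_skip[OF i] divide_inverse[of _ "_ * _"] inverse_mult_distrib inv
      by (simp add: divide_inverse mult_ac del: lessThan_Suc)
  qed
qed

text \<open>
  Schur's evaluation, by expansion along the last row.  The minors are known by induction and
  are compared with \<open>Delta\<close> of the \<open>2 * m + 1\<close> remaining variables, which leaves a sum of the
  form \<open>sum_schur_partial_fractions\<close>.
\<close>

lemma schur_pfaffian:
  fixes x :: "nat \<Rightarrow> 'b::field_char_0"
  assumes "generic (2 * m) x"
  shows "pf m (P_entry f (2 * m) [] x) = Delta (2 * m) x"
  using assms
proof (induction m arbitrary: x)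
  case 0
  then show ?case
    by (simp add: Delta_def)
next
  case (Suc m)
  let ?n = "Suc (2 * m)"
  let ?M = "P_entry f (Suc ?n) [] x"
  define y where "y = x ?n"
  have gen: "generic (Suc ?n) x"
    using Suc.prems by simp
  then have gen': "generic ?n x"
    by (rule generic_Suc_D)
  have xy: "y \<noteq> 0" "i < ?n \<Longrightarrow> y + x i \<noteq> 0" for i
    using gen generic_nonzero[OF gen, of ?n] by (auto simp: generic_def y_def)
  have term_eq: "(- 1) ^ (?n + i) * ?M ?n (skip ?n i) * pf m (\<lambda>a b. ?M (skip ?n (skip i a)) (skip ?n (skip i b)))
      = Delta ?n x * ((y - x i) / (y + x i) * (\<Prod>j\<in>{..<?n} - {i}. (x i + x j) / (x i - x j)))"
    if i: "i \<in> {..2 * m}" for i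
  proof -
    have i': "i \<le> 2 * m"
      using i by simp
    have "pf m (\<lambda>a b. ?M (skip ?n (skip i a)) (skip ?n (skip i b)))
        = pf m (P_entry f (2 * m) [] (\<lambda>j. x (skip i j)))"
      by (intro pf_cong) (auto simp: P_entry_def skip_def)
    also have "\<dots> = Delta (2 * m) (\<lambda>j. x (skip i j))"
      using gen' by (intro Suc.IH generic_skip)
    finally have minor: "pf m (\<lambda>a b. ?M (skip ?n (skip i a)) (skip ?n (skip i b)))
        = Delta (2 * m) (\<lambda>j. x (skip i j))" .
    have entry: "?M ?n (skip ?n i) = - ((y - x i) / (y + x i))"
      using i' by (simp add: P_entry_def skip_def y_def minus_divide_left add.commute)
    have "(\<Prod>j\<in>{..<?n} - {i}. (x i - x j) / (x i + x j)) * (\<Prod>j\<in>{..<?n} - {i}. (x i + x j) / (x i - x j)) = 1"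
      unfolding prod.distrib[symmetric]
    proof (rule prod.neutral, rule ballI)
      fix j assume "j \<in> {..<?n} - {i}"
      then have "x i - x j \<noteq> 0" "x i + x j \<noteq> 0"
        using gen' i' by (auto simp: generic_def inj_on_def)
      then show "(x i - x j) / (x i + x j) * ((x i + x j) / (x i - x j)) = 1"
        by simp
    qed
    then have "Delta ?n x * (\<Prod>j\<in>{..<?n} - {i}. (x i + x j) / (x i - x j))
        = (- 1) ^ i * Delta (2 * m) (\<lambda>j. x (skip i j))"
      unfolding Delta_skip[OF i'] by (simp add: power_add mult.assoc del: lessThan_Suc)
    then show ?thesis
      unfolding minor entry mult.left_commute[of "Delta ?n x"]
      by (simp add: power_add del: lessThan_Suc)
  qed
  have "pf (Suc m) ?M = (\<Sum>i\<le>2 * m. (- 1) ^ (?n + i) * ?M ?n (skip ?n i)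
      * pf m (\<lambda>a b. ?M (skip ?n (skip i a)) (skip ?n (skip i b))))"
    by (intro pf_expand P_entry_skew) simp
  also have "\<dots> = Delta ?n x
      * (\<Sum>i<?n. (y - x i) / (y + x i) * (\<Prod>j\<in>{..<?n} - {i}. (x i + x j) / (x i - x j)))"
    unfolding lessThan_Suc_atMost sum_distrib_left
    by (intro sum.cong refl) (simp only: term_eq lessThan_Suc_atMost)
  also have "\<dots> = Delta ?n x * (\<Prod>j<?n. (y - x j) / (y + x j))"
    using gen' xy generic_nonzero[OF gen']
    by (subst sum_schur_partial_fractions) (auto simp: generic_def simp del: lessThan_Suc)
  also have "\<dots> = Delta (Suc ?n) x"
    unfolding Delta_Suc[of ?n] y_def ..
  finally show ?case
    by simp
qed

lemma P_quot_Nil: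
  fixes x :: "nat \<Rightarrow> 'b::field_char_0"
  assumes "generic n x" "even n"
  shows "P_quot f n [] x = 1"
  using assms schur_pfaffian[of "n div 2" x f] Delta_nonzero[of n x] by (simp add: P_quot_def)

lemma P_quot_star_eq_hl_rec:
  fixes x :: "nat \<Rightarrow> 'b::field_char_0"
  assumes f0: "f 0 = 1" and "generic n x" "length lam \<le> n"
  shows "P_quot f n (star_partition n lam) x = hl_rec f (- 1) lam n x"
  using assms(2,3)
proof (induction lam arbitrary: n x)
  case Nil
  show ?case
  proof (cases "even n")
    case True
    with Nil show ?thesis
      by (simp add: star_partition_def P_quot_Nil)
  next
    case False
    then obtain n' where n: "n = Suc n'" "even n'"
      by (cases n) auto
    have "P_quot f n [0] x = (\<Sum>i<n. poly (f 0) (x i)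
        * (\<Prod>j\<in>{..<n} - {i}. (x i + x j) / (x i - x j)) * P_quot f n' [] (\<lambda>j. x (skip i j)))"
      unfolding n(1) using n(2) by (intro P_quot_Cons) simp
    also have "\<dots> = (\<Sum>i<n. \<Prod>j\<in>{..<n} - {i}. (x i + x j) / (x i - x j))"
      using Nil n by (intro sum.cong refl) (simp add: f0 P_quot_Nil generic_skip del: lessThan_Suc)
    \<comment> \<open>At \<open>t = - 1\<close>, \<open>1 - t ^ n\<close> and \<open>1 - t\<close> both equal \<open>2\<close> since \<open>n\<close> is odd.\<close>
    also have "2 * \<dots> = 2"
      using sum_symmetric_factors[of x n "- 1"] Nil generic_nonzero[of n x] False
      by (simp add: generic_def)
    finally show ?thesis
      using False by (simp add: star_partition_def)
  qed
next
  case (Cons k ks)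
  then obtain n' where n: "n = Suc n'"
    by (cases n) auto
  have "star_partition (Suc n') (k # ks) = k # star_partition n' ks"
    and even: "even (n' + length (star_partition n' ks))"
    by (auto simp: star_partition_def)
  moreover have "P_quot f n' (star_partition n' ks) (\<lambda>j. x (skip i j))
      = hl_rec f (- 1) ks n' (\<lambda>j. x (skip i j))" for i
    using Cons.prems by (intro Cons.IH generic_skip) (simp_all add: n)
  ultimately show ?case
    by (simp add: n P_quot_Cons[OF even] del: lessThan_Suc sum.lessThan_Suc)
qed

lemma P_at_eq_hl_rec:
  fixes x :: "nat \<Rightarrow> 'b::field_char_0"
  assumes "f 0 = 1" "generic n x" "length lam \<le> n"
  shows "P_at f n lam x = hl_rec f (- 1) lam n x"
proof -
  have "even (n + length (star_partition n lam))"
    by (auto simp: star_partition_def)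
  then show ?thesis
    using P_at_eq_P_quot[of n lam f x] P_quot_star_eq_hl_rec[of f n x lam] assms by simp
qed

section \<open>Specialisation of the parameter\<close>

lemma has_value_Fract:
  "poly q a \<noteq> 0 \<Longrightarrow> has_value (Fraction_Field.Fract p q) a (poly p a / poly q a)"
  by (auto simp: has_value_def)

lemma has_value_to_fract: "has_value (to_fract p) a (poly p a)"
  using has_value_Fract[of 1 a p] by (simp add: to_fract_def)

lemma has_value_lift_t: "has_value (lift_t c) a c"
  using has_value_to_fract[of "[:c:]" a] by (simp add: lift_t_def)

lemma has_value_T: "has_value T a a"
  using has_value_to_fract[of "[:0, 1:]" a] by (simp add: T_def)

lemma has_value_add:
  assumes "has_value r a c" "has_value s a d"
  shows "has_value (r + s) a (c + d)"
proof -
  obtain p q where 1: "poly q a \<noteq> 0" "r = Fraction_Field.Fract p q" "c = poly p a / poly q a"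
    using assms(1) by (auto simp: has_value_def)
  obtain p' q' where 2: "poly q' a \<noteq> 0" "s = Fraction_Field.Fract p' q'" "d = poly p' a / poly q' a"
    using assms(2) by (auto simp: has_value_def)
  have nz: "q \<noteq> 0" "q' \<noteq> 0"
    using 1(1) 2(1) by auto
  show ?thesis
    using has_value_Fract[of "q * q'" a "p * q' + p' * q"] 1 2 nz by (simp add: add_frac_eq)
qed

lemma has_value_mult:
  assumes "has_value r a c" "has_value s a d"
  shows "has_value (r * s) a (c * d)"
proof -
  obtain p q where 1: "poly q a \<noteq> 0" "r = Fraction_Field.Fract p q" "c = poly p a / poly q a"
    using assms(1) by (auto simp: has_value_def)
  obtain p' q' where 2: "poly q' a \<noteq> 0" "s = Fraction_Field.Fract p' q'" "d = poly p' a / poly q' a"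
    using assms(2) by (auto simp: has_value_def)
  show ?thesis
    using has_value_Fract[of "q * q'" a "p * p'"] 1 2 by simp
qed

lemma has_value_uminus: "has_value r a c \<Longrightarrow> has_value (- r) a (- c)"
  using has_value_mult[OF has_value_to_fract[of "- 1" a], of r c] by simp

lemma has_value_diff: "has_value r a c \<Longrightarrow> has_value s a d \<Longrightarrow> has_value (r - s) a (c - d)"
  using has_value_add[of r a c "- s" "- d"] has_value_uminus[of s a d] by simp

lemma has_value_inverse:
  assumes "has_value r a c" "c \<noteq> 0"
  shows "has_value (inverse r) a (inverse c)"
proof -
  obtain p q where 1: "poly q a \<noteq> 0" "r = Fraction_Field.Fract p q" "c = poly p a / poly q a"
    using assms(1) by (auto simp: has_value_def)
  then show ?thesis
    using has_value_Fract[of p a q] assms(2) by auto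
qed

lemma has_value_divide:
  "has_value r a c \<Longrightarrow> has_value s a d \<Longrightarrow> d \<noteq> 0 \<Longrightarrow> has_value (r / s) a (c / d)"
  unfolding divide_inverse by (intro has_value_mult has_value_inverse)

lemma has_value_sum:
  assumes "\<And>i. i \<in> A \<Longrightarrow> has_value (r i) a (c i)"
  shows "has_value (sum r A) a (sum c A)"
  using assms
proof (induction A rule: infinite_finite_induct)
  case (insert i A)
  then show ?case
    by (simp add: has_value_add)
qed (use has_value_to_fract[of 0 a] in auto)

lemma has_value_prod:
  assumes "\<And>i. i \<in> A \<Longrightarrow> has_value (r i) a (c i)"
  shows "has_value (prod r A) a (prod c A)"
  using assms
proof (induction A rule: infinite_finite_induct)
  case (insert i A)
  then show ?case
    by (simp add: has_value_mult)
qed (use has_value_to_fract[of 1 a] in auto)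

lemma lift_t_0 [simp]: "lift_t 0 = 0"
  and lift_t_1 [simp]: "lift_t 1 = 1"
  and lift_t_add: "lift_t (c + d) = lift_t c + lift_t d"
  and lift_t_mult: "lift_t (c * d) = lift_t c * lift_t d"
  and lift_t_eq_iff [simp]: "lift_t c = lift_t d \<longleftrightarrow> c = d"
  by (simp_all add: lift_t_def flip: to_fract_add to_fract_mult) (simp add: pCons_one)

lemma poly_map_poly_lift_t: "poly (map_poly lift_t p) (lift_t x) = lift_t (poly p x)"
  by (induction p) (simp_all add: map_poly_pCons lift_t_add lift_t_mult)

text \<open>
  All denominators are differences of distinct variables and do not involve \<open>T\<close>.
\<close>

lemma has_value_hl_rec:
  fixes x :: "nat \<Rightarrow> 'b::field"
  assumes "inj_on x {..<n}" "length lam \<le> n"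
  shows "has_value (hl_rec (\<lambda>d. map_poly lift_t (f d)) T lam n (\<lambda>i. lift_t (x i))) a
    (hl_rec f a lam n x)"
  using assms
proof (induction lam arbitrary: n x)
  case Nil
  then show ?case
    using has_value_lift_t[of 1 a] by simp
next
  case (Cons k ks)
  then obtain n' where n: "n = Suc n'"
    by (cases n) auto
  have IH: "has_value (hl_rec (\<lambda>d. map_poly lift_t (f d)) T ks n' (\<lambda>j. lift_t (x (skip i j)))) a
      (hl_rec f a ks n' (\<lambda>j. x (skip i j)))" for i
    using Cons.prems by (intro Cons.IH inj_on_comp_skip) (simp_all add: n)
  have "x i - x j \<noteq> 0" if "i < n" "j \<in> {..<n} - {i}" for i j
    using inj_onD[OF Cons.prems(1), of i j] that by auto
  then show ?case
    unfolding hl_rec.simps poly_map_poly_lift_t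
    by (intro has_value_sum has_value_mult has_value_prod has_value_divide has_value_diff
        has_value_lift_t has_value_T) (auto simp: n IH)
qed

lemma q_fact_T_nonzero: "q_fact (T :: 'b::field poly fract) m \<noteq> 0"
  and T_neq_1: "(T :: 'b::field poly fract) \<noteq> 1"
proof -
  have pow: "(T :: 'b poly fract) ^ j = to_fract ([:0, 1:] ^ j)" for j
    by (induction j) (simp_all only: power_0 power_Suc to_fract_1 to_fract_mult T_def)
  have neq: "(T :: 'b poly fract) ^ j \<noteq> 1" if "j > 0" for j
  proof
    assume "(T :: 'b poly fract) ^ j = 1"
    then have "to_fract (([:0, 1:] :: 'b poly) ^ j) = to_fract 1"
      by (simp only: pow to_fract_1)
    then have "([:0, 1:] :: 'b poly) ^ j = 1"
      by (simp only: to_fract_eq_iff)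
    \<comment> \<open>Powers of the indeterminate vanish at \<open>0\<close>, the constant \<open>1\<close> does not.\<close>
    then have "poly ([:0, 1:] ^ j) (0 :: 'b) = poly 1 0"
      by simp
    then show False
      using that by (simp add: poly_power zero_power)
  qed
  show 1: "(T :: 'b poly fract) \<noteq> 1"
    using neq[of 1] by simp
  show "q_fact (T :: 'b::field poly fract) m \<noteq> 0"
    unfolding q_fact_def using neq 1 by auto
qed

section \<open>Specialisation to indeterminates\<close>

text \<open>
  Pfaffians are divided by \<open>2 ^ m * fact m\<close>, so characteristic zero has to be known for the field
  of rational functions.
\<close>

instance fract :: ("{idom, ring_char_0}") field_char_0
proof
  show "inj (of_nat :: nat \<Rightarrow> 'a fract)"
    by (rule injI) (simp add: of_nat_fract eq_fract)
qed

lemma const_0 [simp]: "const 0 = 0" and const_1 [simp]: "const 1 = 1"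
  by (simp_all add: const_def single_one)

text \<open>
  Relations between the indeterminates are refuted by their coefficient at the monomial \<open>X i\<close>;
  for \<open>X i + X i\<close> it is \<open>2\<close>.
\<close>

lemma generic_X: "generic n (X :: nat \<Rightarrow> 'a::field_char_0 ratfun)"
proof -
  let ?e = "\<lambda>i::nat. Poly_Mapping.single i (Suc 0)"
  let ?X = "\<lambda>i. Poly_Mapping.single (?e i) (1::'a)"
  have e_inj: "?e i = ?e j \<longleftrightarrow> i = j" for i j :: nat
  proof
    assume "?e i = ?e j"
    then have "Poly_Mapping.lookup (?e i) i = Poly_Mapping.lookup (?e j) i"
      by simp
    then show "i = j"
      by (simp add: Poly_Mapping.lookup_single when_def split: if_splits)
  qed simp
  have X_at: "Poly_Mapping.lookup (?X i) (?e j) = (if i = j then 1 else 0)" for i j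
    by (cases "i = j") (simp_all add: Poly_Mapping.lookup_single e_inj)
  have "X i + X j \<noteq> (0 :: 'a ratfun)" for i j
  proof
    assume "X i + X j = (0 :: 'a ratfun)"
    then have "?X i + ?X j = 0"
      by (simp add: X_def flip: to_fract_add)
    then have "Poly_Mapping.lookup (?X i + ?X j) (?e i) = 0"
      by simp
    then show False
      by (simp add: lookup_add X_at split: if_splits)
  qed
  moreover have "i = j" if "X i = (X j :: 'a ratfun)" for i j
  proof -
    have "?X i = ?X j"
      using that by (simp add: X_def)
    then have "Poly_Mapping.lookup (?X i) (?e i) = Poly_Mapping.lookup (?X j) (?e i)"
      by simp
    then show ?thesis
      by (simp add: X_at split: if_splits)
  qed
  ultimately show ?thesis
    by (simp add: generic_def inj_on_def)
qed

theorem theorem2p3: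
  fixes f :: "nat \<Rightarrow> 'a::field_char_0 poly"
    and n :: nat
    and lam :: "nat list"
  assumes "admissible f"
    and "n \<ge> 1"
    and "strict_partition lam"
    and "length lam \<le> n"
  shows "regular_at (gen_HL f n lam) (- 1) \<and> gen_P f n lam = value_at (gen_HL f n lam) (- 1)"
proof -
  let ?F = "\<lambda>d. map_poly const (f d)"
  have F0: "?F 0 = 1"
    using assms(1) by (simp add: admissible_def map_poly_1')
  have inj: "inj_on (X :: nat \<Rightarrow> 'a ratfun) {..<n}"
    using generic_X[of n, where 'a = 'a] by (simp add: generic_def)
  have "gen_HL f n lam = HL_at (\<lambda>d. map_poly lift_t (?F d)) n lam (\<lambda>i. lift_t (X i)) T"
    by (simp add: gen_HL_def map_poly_map_poly o_def)
  also have "\<dots> = hl_rec (\<lambda>d. map_poly lift_t (?F d)) T lam n (\<lambda>i. lift_t (X i))"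
  proof (rule HL_at_eq_hl_rec)
    show "map_poly lift_t (?F 0) = 1"
      by (simp add: F0 map_poly_1')
    show "inj_on (\<lambda>i. lift_t (X i :: 'a ratfun)) {..<n}"
      using inj by (simp add: inj_on_def)
    show "lift_t (X i :: 'a ratfun) \<noteq> 0" if "i < n" for i
      using generic_nonzero[OF generic_X that] lift_t_eq_iff[of "X i :: 'a ratfun" 0] by simp
  qed (simp_all add: assms T_neq_1 q_fact_T_nonzero)
  finally have val: "has_value (gen_HL f n lam) (- 1) (hl_rec ?F (- 1) lam n X)"
    using has_value_hl_rec[OF inj assms(4), of ?F "- 1"] by simp
  moreover have "gen_P f n lam = hl_rec ?F (- 1) lam n X"
    unfolding gen_P_def by (rule P_at_eq_hl_rec) (simp_all add: F0 generic_X assms)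
  ultimately show ?thesis
    using value_at_eqI[OF val] by (auto simp: regular_at_def)
qed

end
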